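(* Let $d, \mathbf{d}, \mathbf{L} \in \mathbb{N}$, $A \in (0,\infty)$, $L, a \in \mathbb{R}$, $b \in (a,\infty)$, $u \in [-\infty,\infty)$, $v \in (u,\infty]$, $\mathbf{l} = (\mathbf{l}_0, \mathbf{l}_1, \ldots, \mathbf{l}_{\mathbf{L}}) \in \mathbb{N}^{\mathbf{L}+1}$, assume $\mathbf{L} \geq \frac{A \mathbbm{1}_{(6^d,\infty)}(A)}{2d} + 1$, $\mathbf{l}_0 = d$, $\mathbf{l}_1 \geq A \mathbbm{1}_{(6^d,\infty)}(A)$, $\mathbf{l}_{\mathbf{L}} = 1$, and $\mathbf{d} \geq \sum_{i=1}^{\mathbf{L}} \mathbf{l}_i(\mathbf{l}_{i-1}+1)$, assume for all $i \in \{2,3,\ldots\} \cap [0,\mathbf{L})$ that $\mathbf{l}_i \geq \mathbbm{1}_{(6^d,\infty)}(A) \max\{A/d - 2i + 3, 2\}$, and let $f \colon [a,b]^d \to ([u,v] \cap \mathbb{R})$ satisfy for all $x, y \in [a,b]^d$ that $|f(x) - f(y)| \leq L \|x-y\|_1$. Then there exists $\vartheta \in \mathbb{R}^{\mathbf{d}}$ such that $\|\vartheta\|_\infty \leq \max\{1, L, |a|, |b|, 2[\sup_{x \in [a,b]^d} |f(x)|]\}$ and $$\sup_{x \in [a,b]^d} |\mathcal{N}^{\vartheta,\mathbf{l}}_{u,v}(x) - f(x)| \leq \frac{3 d L (b-a)}{A^{1/d}}.$$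
   Context: $\mathbb{N} = \{1,2,\ldots\}$, $\mathbb{N}_0 = \{0,1,2,\ldots\}$; $\mathbbm{1}_S$ is the indicator function of $S$; $\|x\|_1 = \sum_i |x_i|$ and $\|x\|_\infty = \max_i |x_i|$. Affine maps: for $\mathbf{d}, m, n \in \mathbb{N}$, $s \in \mathbb{N}_0$, $\theta \in \mathbb{R}^{\mathbf{d}}$ with $\mathbf{d} \geq s + mn + m$, $\mathcal{A}^{\theta,s}_{m,n} \colon \mathbb{R}^n \to \mathbb{R}^m$ is $\mathcal{A}^{\theta,s}_{m,n}(x) = Wx + \beta$ with $W_{i,j} = \theta_{s+(i-1)n+j}$ and $\beta_i = \theta_{s+mn+i}$ ($1 \le i \le m$, $1 \le j \le n$). Rectified clipped DNN: for $\mathbf{d}, \mathbf{L} \in \mathbb{N}$, $u \in [-\infty,\infty)$, $v \in (u,\infty]$, $\mathbf{l} = (\mathbf{l}_0,\ldots,\mathbf{l}_{\mathbf{L}}) \in \mathbb{N}^{\mathbf{L}+1}$, $\theta \in \mathbb{R}^{\mathbf{d}}$ with $\mathbf{d} \geq \sum_{i=1}^{\mathbf{L}} \mathbf{l}_i(\mathbf{l}_{i-1}+1)$, let $s_k = \sum_{i=1}^{k-1} \mathbf{l}_i(\mathbf{l}_{i-1}+1)$ (so $s_1 = 0$). Let $R_n \colon \mathbb{R}^n \to \mathbb{R}^n$ apply $x \mapsto \max\{x,0\}$ componentwise and let $C_{u,v,n} \colon \mathbb{R}^n \to \mathbb{R}^n$ apply $x \mapsto \max\{u,\min\{x,v\}\}$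 componentwise. Then $\mathcal{N}^{\theta,\mathbf{l}}_{u,v} \colon \mathbb{R}^{\mathbf{l}_0} \to \mathbb{R}^{\mathbf{l}_{\mathbf{L}}}$ is $\mathcal{N}^{\theta,\mathbf{l}}_{u,v} = C_{u,v,\mathbf{l}_{\mathbf{L}}} \circ \mathcal{A}^{\theta,s_{\mathbf{L}}}_{\mathbf{l}_{\mathbf{L}},\mathbf{l}_{\mathbf{L}-1}} \circ R_{\mathbf{l}_{\mathbf{L}-1}} \circ \mathcal{A}^{\theta,s_{\mathbf{L}-1}}_{\mathbf{l}_{\mathbf{L}-1},\mathbf{l}_{\mathbf{L}-2}} \circ \cdots \circ R_{\mathbf{l}_1} \circ \mathcal{A}^{\theta,0}_{\mathbf{l}_1,\mathbf{l}_0}$ (for $\mathbf{L}=1$: $C_{u,v,\mathbf{l}_1} \circ \mathcal{A}^{\theta,0}_{\mathbf{l}_1,\mathbf{l}_0}$). *)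

theory Defs
  imports
    Complex_Main
    "HOL-Library.Extended_Real"
    "HOL-Library.Indicator_Function"
    "Jordan_Normal_Form.Matrix"
begin

text \<open>Elements of \<open>\<real>\<^sup>n\<close> are vectors in \<^term>\<open>carrier_vec n\<close>, whose entries are indexed by
  \<open>0, \<dots>, n - 1\<close>. Hence the coordinate with one-based index \<open>s + (i - 1) n + j\<close> is the
  entry \<open>s + i n + j\<close> for zero-based \<open>i\<close> and \<open>j\<close>.\<close>

definition affine_map :: "real vec \<Rightarrow> nat \<Rightarrow> nat \<Rightarrow> nat \<Rightarrow> real vec \<Rightarrow> real vec" where
  "affine_map \<theta> s m n x =
     mat m n (\<lambda>(i, j). \<theta> $ (s + i * n + j)) *\<^sub>v x + vec m (\<lambda>i. \<theta> $ (s + m * n + i))"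

definition relu_vec :: "real vec \<Rightarrow> real vec" where
  "relu_vec = map_vec (\<lambda>t. max t 0)"

text \<open>The conversion back to \<^typ>\<open>real\<close> in \<open>clip_vec\<close> is lossless when \<open>u < \<infinity>\<close> and \<open>u < v\<close>,
  since then the clipped value is finite.\<close>

definition clip_vec :: "ereal \<Rightarrow> ereal \<Rightarrow> real vec \<Rightarrow> real vec" where
  "clip_vec u v = map_vec (\<lambda>t. real_of_ereal (max u (min (ereal t) v)))"

text \<open>A layer structure \<open>(l\<^sub>0, \<dots>, l\<^sub>L)\<close> is a list of length \<open>L + 1\<close>.\<close>

definition layer_offset :: "nat list \<Rightarrow> nat \<Rightarrow> nat" where
  "layer_offset l k = (\<Sum>i = 1..<k. l ! i * (l ! (i - 1) + 1))"

primrec dnn_hidden :: "real vec \<Rightarrow> nat list \<Rightarrow> nat \<Rightarrow> real vec \<Rightarrow> real vec" where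
  "dnn_hidden \<theta> l 0 x = x"
| "dnn_hidden \<theta> l (Suc k) x =
     relu_vec (affine_map \<theta> (layer_offset l (Suc k)) (l ! Suc k) (l ! k) (dnn_hidden \<theta> l k x))"

definition clipped_dnn :: "ereal \<Rightarrow> ereal \<Rightarrow> real vec \<Rightarrow> nat list \<Rightarrow> real vec \<Rightarrow> real vec" where
  "clipped_dnn u v \<theta> l x =
     (let L = length l - 1 in
      clip_vec u v
        (affine_map \<theta> (layer_offset l L) (l ! L) (l ! (L - 1)) (dnn_hidden \<theta> l (L - 1) x)))"

definition l1_norm :: "real vec \<Rightarrow> real" where
  "l1_norm x = (\<Sum>i < dim_vec x. \<bar>x $ i\<bar>)"

text \<open>Only meaningful for vectors of positive dimension.\<close>

definition max_norm :: "real vec \<Rightarrow> real" where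
  "max_norm x = Max ((\<lambda>i. \<bar>x $ i\<bar>) ` {..<dim_vec x})"

definition cube :: "real \<Rightarrow> real \<Rightarrow> nat \<Rightarrow> real vec set" where
  "cube a b d = {x \<in> carrier_vec d. \<forall>i < d. x $ i \<in> {a..b}}"

end

theory Submission
  imports Defs "HOL-Library.FuncSet"
begin

text \<open>If \<open>A \<le> 6\<^sup>d\<close>, the constant value of \<open>f\<close> at the centre of the cube is accurate enough. Otherwise
  put \<open>N = \<lfloor>A\<^sup>1\<^sup>/\<^sup>d / 2\<rfloor>\<close>, so that \<open>N \<ge> A\<^sup>1\<^sup>/\<^sup>d / 3\<close>, and let \<open>y\<^sub>0, \<dots>, y\<^sub>K\<^sub>-\<^sub>1\<close> be the midpoints of the
  \<open>K = N\<^sup>d \<le> A / (2 d)\<close> cells of the regular grid. By the Lipschitz condition,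
  \<open>max\<^sub>k (f y\<^sub>k - L \<parallel>x - y\<^sub>k\<parallel>\<^sub>1)\<close> never exceeds \<open>f x\<close> and falls short of it by at most twice \<open>L\<close> times the
  distance from \<open>x\<close> to the grid, that is by at most \<open>L d (b - a) / N\<close>. A network computes this maximum
  one term at a time: the first layer yields the positive and negative parts of the coordinates of
  \<open>x - y\<^sub>k\<close>, each following layer absorbs one more term by \<open>max m z = (m - z)\<^sup>+ + z\<^sup>+ - (-z)\<^sup>+\<close> while passing
  on the remaining terms as pairs of positive and negative parts, and the surplus layers just
  pass on the maximum. Clipping does not increase the error since \<open>f x \<in> [u, v]\<close>.\<close>


section \<open>Single neurons with bounded weights and bias\<close>

text \<open>Here \<open>g\<close> is a possible preactivation of one neuron fed with
  \<open>h x 0\<close>, ..., \<open>h x (n - 1)\<close>. Weights and bias are chosen before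
  \<open>x\<close>, so a network can be designed neuron by neuron without mentioning positions in
  the parameter vector.\<close>

definition affinely_representable ::
    "real \<Rightarrow> nat \<Rightarrow> ('x \<Rightarrow> nat \<Rightarrow> real) \<Rightarrow> 'x set \<Rightarrow> ('x \<Rightarrow> real) \<Rightarrow> bool" where
  "affinely_representable c n h X g \<longleftrightarrow>
     (\<exists>w \<beta>. (\<forall>j<n. \<bar>w j\<bar> \<le> c) \<and> \<bar>\<beta>\<bar> \<le> c \<and> (\<forall>x\<in>X. g x = (\<Sum>j<n. w j * h x j) + \<beta>))"

lemma affinely_representableI:
  assumes "\<And>j. j < n \<Longrightarrow> \<bar>w j\<bar> \<le> c" "\<bar>\<beta>\<bar> \<le> c"
    and "\<And>x. x \<in> X \<Longrightarrow> g x = (\<Sum>j<n. w j * h x j) + \<beta>"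
  shows "affinely_representable c n h X g"
  using assms unfolding affinely_representable_def by blast

lemma affinely_representable_zero:
  "c \<ge> 0 \<Longrightarrow> affinely_representable c n h X (\<lambda>x. 0)"
  by (rule affinely_representableI[where w = "\<lambda>_. 0" and \<beta> = 0]) auto

lemma affinely_representable_uminus:
  assumes "affinely_representable c n h X g"
  shows "affinely_representable c n h X (\<lambda>x. - g x)"
proof -
  obtain w \<beta> where "\<forall>j<n. \<bar>w j\<bar> \<le> c" "\<bar>\<beta>\<bar> \<le> c" "\<forall>x\<in>X. g x = (\<Sum>j<n. w j * h x j) + \<beta>"
    using assms unfolding affinely_representable_def by blast
  then show ?thesis
    by (intro affinely_representableI[where w = "\<lambda>j. - w j" and \<beta> = "- \<beta>"])
       (auto simp: sum_negf)
qed

text \<open>All weights are 1, -1 or 0, so \<open>c \<ge> 1\<close> suffices. Up to sign, the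
  nonzero preactivations of the maximum network from the third layer on have this form.\<close>

lemma affinely_representable_sum_diff:
  fixes h :: "'x \<Rightarrow> nat \<Rightarrow> real"
  assumes "c \<ge> 1" and "P \<subseteq> {..<n}" "Q \<subseteq> {..<n}" "P \<inter> Q = {}"
    and "\<And>x. x \<in> X \<Longrightarrow> g x = (\<Sum>j\<in>P. h x j) - (\<Sum>j\<in>Q. h x j)"
  shows "affinely_representable c n h X g"
proof (rule affinely_representableI[where w = "\<lambda>j. indicator P j - indicator Q j" and \<beta> = 0])
  fix x assume "x \<in> X"
  have "(\<Sum>j<n. (indicator P j - indicator Q j) * h x j)
      = (\<Sum>j<n. indicator P j * h x j) - (\<Sum>j<n. indicator Q j * h x j)"
    by (simp add: left_diff_distrib sum_subtractf)
  also have "(\<Sum>j<n. indicator P j * h x j) = (\<Sum>j\<in>P. h x j)"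
    using assms(2) by (simp add: indicator_def if_distrib sum.If_cases Int_absorb1 cong: if_cong)
  also have "(\<Sum>j<n. indicator Q j * h x j) = (\<Sum>j\<in>Q. h x j)"
    using assms(3) by (simp add: indicator_def if_distrib sum.If_cases Int_absorb1 cong: if_cong)
  finally show "g x = (\<Sum>j<n. (indicator P j - indicator Q j) * h x j) + 0"
    using assms(5)[OF \<open>x \<in> X\<close>] by simp
qed (use assms(1,4) in \<open>auto simp: indicator_def\<close>)

section \<open>From neurons to a parameter vector\<close>

lemma layer_offset_Suc:
  "k \<ge> 1 \<Longrightarrow> layer_offset l (Suc k) = layer_offset l k + l ! k * (l ! (k - 1) + 1)"
  by (simp add: layer_offset_def)

lemma layer_offset_mono: "k \<le> k' \<Longrightarrow> layer_offset l k \<le> layer_offset l k'"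
  unfolding layer_offset_def by (intro sum_mono2) auto

lemma row_major_index_less: "i < m \<Longrightarrow> j < n \<Longrightarrow> i * n + j < m * (n::nat)"
  using mult_le_mono1[of "Suc i" m n] by simp

text \<open>The blocks of the layers occupy consecutive disjoint index ranges, so by induction a new
  block can be written behind the earlier ones. The bound covers all indices because
  \<open>dd\<close> may exceed the number of parameters in use.\<close>

lemma parameters_exist:
  fixes W :: "nat \<Rightarrow> nat \<Rightarrow> nat \<Rightarrow> real" and B :: "nat \<Rightarrow> nat \<Rightarrow> real"
  assumes c: "c \<ge> 0"
    and W: "\<And>k i j. k < LL \<Longrightarrow> i < l ! Suc k \<Longrightarrow> j < l ! k \<Longrightarrow> \<bar>W k i j\<bar> \<le> c"
    and B: "\<And>k i. k < LL \<Longrightarrow> i < l ! Suc k \<Longrightarrow> \<bar>B k i\<bar> \<le> c"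
  shows "\<exists>\<theta>. (\<forall>p. \<bar>\<theta> p\<bar> \<le> c) \<and>
    (\<forall>k<LL. \<forall>i<l ! Suc k.
       (\<forall>j<l ! k. \<theta> (layer_offset l (Suc k) + i * l ! k + j) = W k i j) \<and>
       \<theta> (layer_offset l (Suc k) + l ! Suc k * l ! k + i) = B k i)"
  using W B
proof (induction LL)
  case 0
  show ?case using c by (intro exI[of _ "\<lambda>_. 0"]) auto
next
  case (Suc K)
  obtain \<theta> where \<theta>: "\<forall>p. \<bar>\<theta> p\<bar> \<le> c"
    "\<And>k i j. k < K \<Longrightarrow> i < l ! Suc k \<Longrightarrow> j < l ! k \<Longrightarrow>
       \<theta> (layer_offset l (Suc k) + i * l ! k + j) = W k i j"
    "\<And>k i. k < K \<Longrightarrow> i < l ! Suc k \<Longrightarrow>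
       \<theta> (layer_offset l (Suc k) + l ! Suc k * l ! k + i) = B k i"
    using Suc by (metis less_SucI)
  define o' m n where "o' = layer_offset l (Suc K)" and "m = l ! Suc K" and "n = l ! K"
  \<comment> \<open>Old entries come first, then the weights, whose row-major index is decoded by
    \<open>div\<close> and \<open>mod\<close>, then the biases. The default 0 respects the
    bound.\<close>
  define \<theta>' where "\<theta>' p = (if p < o' then \<theta> p else
      if p - o' < m * n then W K ((p - o') div n) ((p - o') mod n) else
      if p - o' - m * n < m then B K (p - o' - m * n) else 0)" for p
  have "\<bar>\<theta>' p\<bar> \<le> c" for p
  proof -
    have "\<bar>W K (q div n) (q mod n)\<bar> \<le> c" if "q < m * n" for q
    proof -
      have "n > 0" using that by (cases n) auto
      then show ?thesis using that Suc.prems(1)[of K]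
        by (simp add: m_def n_def less_mult_imp_div_less)
    qed
    then show ?thesis
      using \<theta>(1) c Suc.prems(2)[of K] by (auto simp: \<theta>'_def m_def)
  qed
  moreover have "\<theta>' (layer_offset l (Suc k) + i * l ! k + j) = W k i j"
    if k: "k < Suc K" and i: "i < l ! Suc k" and j: "j < l ! k" for k i j
  proof (cases "k = K")
    case True
    then show ?thesis using row_major_index_less[of i m j n] i j
      by (auto simp: \<theta>'_def o'_def m_def n_def add.assoc)
  next
    case False
    then have "Suc (Suc k) \<le> Suc K" using k by simp
    from layer_offset_mono[OF this, of l]
    have "layer_offset l (Suc k) + i * l ! k + j < o'"
      using row_major_index_less[OF i j] by (simp add: layer_offset_Suc o'_def)
    then show ?thesis using \<theta>(2)[of k i j] False k i j by (simp add: \<theta>'_def)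
  qed
  moreover have "\<theta>' (layer_offset l (Suc k) + l ! Suc k * l ! k + i) = B k i"
    if k: "k < Suc K" and i: "i < l ! Suc k" for k i
  proof (cases "k = K")
    case True
    then show ?thesis using i
      by (auto simp: \<theta>'_def o'_def m_def n_def add.assoc)
  next
    case False
    then have "Suc (Suc k) \<le> Suc K" using k by simp
    from layer_offset_mono[OF this, of l]
    have "layer_offset l (Suc k) + l ! Suc k * l ! k + i < o'"
      using i by (simp add: layer_offset_Suc o'_def)
    then show ?thesis using \<theta>(3)[of k i] False k i by (simp add: \<theta>'_def)
  qed
  ultimately show ?case by blast
qed

lemma affine_map_vec:
  assumes "dim_vec x = n" "i < m"
  shows "affine_map \<theta> s m n x $ i = (\<Sum>j<n. \<theta> $ (s + i * n + j) * x $ j) + \<theta> $ (s + m * n + i)"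
  using assms by (simp add: affine_map_def scalar_prod_def atLeast0LessThan)

lemma dim_affine_map [simp]: "dim_vec (affine_map \<theta> s m n x) = m"
  by (simp add: affine_map_def)

text \<open>Reduces the construction of a network to naming the preactivations \<open>pre k\<close>
  and the activations \<open>h k\<close> of each layer. The last layer is clipped rather than
  rectified, so the output is read off \<open>pre LL\<close>.\<close>

lemma clipped_dnn_realizes:
  fixes pre :: "nat \<Rightarrow> real vec \<Rightarrow> nat \<Rightarrow> real" and h :: "nat \<Rightarrow> real vec \<Rightarrow> nat \<Rightarrow> real"
  assumes len: "length l = LL + 1" and LL: "LL \<ge> 1" and c: "c \<ge> 0" and dd: "dd \<ge> 1"
    and dim: "dd \<ge> (\<Sum>i = 1..LL. l ! i * (l ! (i - 1) + 1))"
    and X: "X \<subseteq> carrier_vec (l ! 0)" and out: "l ! LL = 1"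
    and rep: "\<And>k i. k < LL \<Longrightarrow> i < l ! Suc k \<Longrightarrow>
      affinely_representable c (l ! k) (h k) X (\<lambda>x. pre (Suc k) x i)"
    and h0: "\<And>x j. x \<in> X \<Longrightarrow> j < l ! 0 \<Longrightarrow> h 0 x j = x $ j"
    and hS: "\<And>k x i. x \<in> X \<Longrightarrow> h (Suc k) x i = max (pre (Suc k) x i) 0"
  shows "\<exists>\<theta> \<in> carrier_vec dd. max_norm \<theta> \<le> c \<and>
    (\<forall>x\<in>X. clipped_dnn u v \<theta> l x $ 0 = real_of_ereal (max u (min (ereal (pre LL x 0)) v)))"
proof -
  define Q where "Q k i w \<beta> \<longleftrightarrow> (\<forall>j<l ! k. \<bar>w j\<bar> \<le> c) \<and> \<bar>\<beta>\<bar> \<le> c \<and>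
      (\<forall>x\<in>X. pre (Suc k) x i = (\<Sum>j<l ! k. w j * h k x j) + \<beta>)" for k i w \<beta>
  have "\<forall>k i. \<exists>w \<beta>. k < LL \<longrightarrow> i < l ! Suc k \<longrightarrow> Q k i w \<beta>"
    using rep unfolding affinely_representable_def Q_def by blast
  then obtain W B where "\<And>k i. k < LL \<Longrightarrow> i < l ! Suc k \<Longrightarrow> Q k i (W k i) (B k i)"
    by metis
  note WB = this[unfolded Q_def]
  obtain \<theta> where \<theta>: "\<forall>p. \<bar>\<theta> p\<bar> \<le> c" "\<forall>k<LL. \<forall>i<l ! Suc k.
       (\<forall>j<l ! k. \<theta> (layer_offset l (Suc k) + i * l ! k + j) = W k i j) \<and>
       \<theta> (layer_offset l (Suc k) + l ! Suc k * l ! k + i) = B k i"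
    using parameters_exist[of c LL l W B] c WB by blast
  define \<Theta> where "\<Theta> = vec dd \<theta>"
  \<comment> \<open>Layers are counted from 1, so the offset of the fictitious layer
    \<open>Suc LL\<close> is the total number of parameters.\<close>
  have total: "layer_offset l (Suc LL) \<le> dd"
    using dim by (simp add: layer_offset_def atLeastLessThanSuc_atLeastAtMost)
  have affine: "affine_map \<Theta> (layer_offset l (Suc k)) (l ! Suc k) (l ! k) y
      = vec (l ! Suc k) (pre (Suc k) x)"
    if k: "k < LL" and x: "x \<in> X" and y: "y = vec (l ! k) (h k x)" for k x y
  proof (rule eq_vecI)
    fix i assume "i < dim_vec (vec (l ! Suc k) (pre (Suc k) x))"
    then have i: "i < l ! Suc k" by simp
    have "layer_offset l (Suc (Suc k)) \<le> dd"
      using layer_offset_mono[of "Suc (Suc k)" "Suc LL" l] k total by simp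
    then have bd: "layer_offset l (Suc k) + l ! Suc k * l ! k + l ! Suc k \<le> dd"
      by (simp add: layer_offset_Suc)
    have "layer_offset l (Suc k) + i * l ! k + j < dd" if "j < l ! k" for j
    proof -
      have "i * l ! k + j < l ! Suc k * l ! k"
        using that i by (simp add: row_major_index_less)
      then show ?thesis using bd by simp
    qed
    then have "affine_map \<Theta> (layer_offset l (Suc k)) (l ! Suc k) (l ! k) y $ i
      = (\<Sum>j<l ! k. W k i j * h k x j) + B k i"
      using i k bd by (subst affine_map_vec) (auto simp: y \<Theta>_def \<theta>(2) intro!: sum.cong)
    also have "\<dots> = pre (Suc k) x i" using WB[OF k i] x by simp
    finally show "affine_map \<Theta> (layer_offset l (Suc k)) (l ! Suc k) (l ! k) y $ i
      = vec (l ! Suc k) (pre (Suc k) x) $ i" using i by simp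
  qed simp
  have hidden: "dnn_hidden \<Theta> l k x = vec (l ! k) (h k x)" if "k < LL" "x \<in> X" for k x
    using that(1)
  proof (induction k)
    case 0
    show ?case using X that(2) h0 by (auto intro!: eq_vecI)
  next
    case (Suc k)
    then have "affine_map \<Theta> (layer_offset l (Suc k)) (l ! Suc k) (l ! k) (dnn_hidden \<Theta> l k x)
      = vec (l ! Suc k) (pre (Suc k) x)"
      using affine[OF _ that(2)] by simp
    then show ?case using that(2) by (auto simp: relu_vec_def hS intro!: eq_vecI)
  qed
  have "clipped_dnn u v \<Theta> l x $ 0 = real_of_ereal (max u (min (ereal (pre LL x 0)) v))"
    if x: "x \<in> X" for x
  proof -
    obtain k where k: "LL = Suc k" using LL by (cases LL) auto
    show ?thesis
      using affine[of k x, OF _ x hidden[of k x]] x k out len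
      by (simp add: clipped_dnn_def Let_def clip_vec_def)
  qed
  moreover have "max_norm \<Theta> \<le> c"
    using dd \<theta>(1) unfolding max_norm_def by (subst Max_le_iff) (auto simp: \<Theta>_def lessThan_empty_iff)
  ultimately show ?thesis by (intro bexI[of _ \<Theta>]) (auto simp: \<Theta>_def)
qed

section \<open>Distances and midpoint grids in the cube\<close>

lemma cubeD: "x \<in> cube a b d \<Longrightarrow> x \<in> carrier_vec d" "x \<in> cube a b d \<Longrightarrow> j < d \<Longrightarrow> x $ j \<in> {a..b}"
  by (auto simp: cube_def)

lemma l1_norm_minus:
  assumes "y \<in> carrier_vec d"
  shows "l1_norm (x - y) = (\<Sum>j<d. \<bar>x $ j - y $ j\<bar>)"
  using assms by (auto simp: l1_norm_def intro!: sum.cong)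

lemma l1_norm_minus_le:
  assumes "y \<in> carrier_vec d" "\<And>j. j < d \<Longrightarrow> \<bar>x $ j - y $ j\<bar> \<le> r"
  shows "l1_norm (x - y) \<le> real d * r"
  using sum_bounded_above[of "{..<d}" "\<lambda>j. \<bar>x $ j - y $ j\<bar>" r] assms
  by (simp add: l1_norm_minus)

text \<open>After rescaling to \<open>s\<close> in \<open>[0, N]\<close> the cells have length 1,
  and the floor of \<open>s\<close> selects a cell whose midpoint is within 1/2.\<close>

lemma interval_midpoint_grid:
  fixes a b t :: real
  assumes "a < b" "N \<ge> (1::nat)" "t \<in> {a..b}"
  shows "\<exists>i<N. \<bar>t - (a + (b - a) * (real i + 1 / 2) / real N)\<bar> \<le> (b - a) / (2 * real N)"
proof -
  define s where "s = (t - a) * real N / (b - a)"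
  have t: "t = a + (b - a) * s / real N"
    using assms by (simp add: s_def)
  have "s \<ge> 0" using assms by (simp add: s_def)
  have "(t - a) * real N \<le> (b - a) * real N" using assms by (intro mult_right_mono) auto
  then have "s \<le> real N" using assms by (simp add: s_def divide_le_eq mult.commute)
  have "\<exists>i<N. \<bar>s - (real i + 1 / 2)\<bar> \<le> 1 / 2"
  proof (cases "s < real N")
    case True
    have "nat \<lfloor>s\<rfloor> < N" using True \<open>s \<ge> 0\<close> by linarith
    moreover have "\<bar>s - (real (nat \<lfloor>s\<rfloor>) + 1 / 2)\<bar> \<le> 1 / 2"
      using \<open>s \<ge> 0\<close> by (simp add: abs_le_iff field_simps) linarith
    ultimately show ?thesis by blast
  next
    \<comment> \<open>The right endpoint \<open>s = N\<close> lies in the last cell, although its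
      floor is \<open>N\<close>.\<close>
    case False
    then show ?thesis using \<open>s \<le> real N\<close> assms(2)
      by (intro exI[of _ "N - 1"]) (auto simp: of_nat_diff)
  qed
  then obtain i where i: "i < N" "\<bar>s - (real i + 1 / 2)\<bar> \<le> 1 / 2" by blast
  have "t - (a + (b - a) * (real i + 1 / 2) / real N) = (b - a) / real N * (s - (real i + 1 / 2))"
    using assms(2) by (simp add: t field_simps)
  also have "\<bar>\<dots>\<bar> = (b - a) / real N * \<bar>s - (real i + 1 / 2)\<bar>"
    using assms by (simp add: abs_mult)
  also have "\<dots> \<le> (b - a) / real N * (1 / 2)"
    using assms i(2) by (intro mult_left_mono) auto
  finally show ?thesis using i(1) by (intro exI[of _ i]) simp
qed

text \<open>A product of one-dimensional grids: a grid point is a function from coordinates to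
  cells, and the \<open>N ^ d\<close> such functions are enumerated by a bijection. The bound is
  coordinatewise, so the cell can be chosen separately in each coordinate.\<close>

lemma cube_grid:
  assumes ab: "a < b" and N: "N \<ge> 1"
  shows "\<exists>y. (\<forall>k<N ^ d. y k \<in> cube a b d) \<and>
    (\<forall>x\<in>cube a b d. \<exists>k<N ^ d. \<forall>j<d. \<bar>x $ j - y k $ j\<bar> \<le> (b - a) / (2 * real N))"
proof -
  define S where "S = ({..<d} \<rightarrow>\<^sub>E {..<N})"
  have "card S = N ^ d" by (simp add: S_def card_PiE)
  moreover have "finite S" by (simp add: S_def finite_PiE)
  ultimately obtain e where e: "bij_betw e {..<N ^ d} S"
    using ex_bij_betw_nat_finite[of S] by (auto simp: atLeast0LessThan)
  define y where "y k = vec d (\<lambda>j. a + (b - a) * (real (e k j) + 1 / 2) / real N)" for k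
  have "y k \<in> cube a b d" if "k < N ^ d" for k
  proof -
    have "e k \<in> S" using e that by (auto simp: bij_betw_def)
    then have lt: "e k j < N" if "j < d" for j using that by (auto simp: S_def)
    have "a + (b - a) * (real (e k j) + 1 / 2) / real N \<in> {a..b}" if "j < d" for j
    proof -
      have "real (e k j) + 1 \<le> real N" using lt[OF that] by linarith
      then have "(b - a) * (real (e k j) + 1 / 2) \<le> (b - a) * real N"
        using ab by (intro mult_left_mono) auto
      moreover have "0 \<le> (b - a) * (real (e k j) + 1 / 2)" using ab by simp
      ultimately have "(b - a) * (real (e k j) + 1 / 2) / real N \<le> b - a"
        using N by (simp only: divide_le_eq) simp
      then show ?thesis using ab by simp
    qed
    then show ?thesis by (auto simp: y_def cube_def)
  qed
  moreover have "\<exists>k<N ^ d. \<forall>j<d. \<bar>x $ j - y k $ j\<bar> \<le> (b - a) / (2 * real N)"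
    if x: "x \<in> cube a b d" for x
  proof -
    have "\<forall>j. \<exists>i. j < d \<longrightarrow> i < N \<and>
        \<bar>x $ j - (a + (b - a) * (real i + 1 / 2) / real N)\<bar> \<le> (b - a) / (2 * real N)"
      using interval_midpoint_grid[OF ab N] cubeD(2)[OF x] by blast
    then obtain D where D: "\<And>j. j < d \<Longrightarrow> D j < N \<and>
        \<bar>x $ j - (a + (b - a) * (real (D j) + 1 / 2) / real N)\<bar> \<le> (b - a) / (2 * real N)"
      by metis
    have "restrict D {..<d} \<in> S" using D by (auto simp: S_def)
    then obtain k where "k < N ^ d" "e k = restrict D {..<d}"
      using e by (metis bij_betw_def imageE lessThan_iff)
    then show ?thesis using D by (intro exI[of _ k]) (auto simp: y_def)
  qed
  ultimately show ?thesis by blast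
qed

section \<open>A network for the maximum of cones\<close>

text \<open>An absolute value is the sum of the positive and the negative part, held here by an even
  neuron and the odd neuron after it.\<close>

lemma sum_abs_as_relu:
  fixes g :: "nat \<Rightarrow> real"
  shows "(\<Sum>n<2 * d. max (if even n then g (n div 2) else - g (n div 2)) 0) = (\<Sum>j<d. \<bar>g j\<bar>)"
  by (induction d) (auto simp: max_def)

text \<open>For \<open>2 \<le> i \<le> K\<close>, layer \<open>i\<close> holds
  \<open>K - (i - 1)\<close> pairs and one excess, that is \<open>2 * K + 3 - 2 * i\<close> neurons;
  writing \<open>+ 2 * i\<close> on the left avoids truncated subtraction. Hidden layers beyond
  \<open>K\<close> need only two neurons.\<close>

lemma max_network:
  fixes y :: "nat \<Rightarrow> real vec" and \<eta> :: "nat \<Rightarrow> real"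
  assumes len: "length l = LL + 1" and dd: "dd \<ge> 1" and d: "d \<ge> 1" and K: "K \<ge> 2" and LL: "LL \<ge> K + 1"
    and dim: "dd \<ge> (\<Sum>i = 1..LL. l ! i * (l ! (i - 1) + 1))"
    and l0: "l ! 0 = d" and out: "l ! LL = 1"
    and l1: "l ! 1 \<ge> 2 * d * K"
    and li: "\<And>i. 2 \<le> i \<Longrightarrow> i < LL \<Longrightarrow> l ! i \<ge> 2 \<and> l ! i + 2 * i \<ge> 2 * K + 3"
    and c: "c \<ge> 1" "\<bar>L\<bar> \<le> c"
    and y: "\<And>k. k < K \<Longrightarrow> y k \<in> carrier_vec d" "\<And>k j. k < K \<Longrightarrow> j < d \<Longrightarrow> \<bar>y k $ j\<bar> \<le> c"
    and \<eta>: "\<And>k. k < K \<Longrightarrow> 2 * \<bar>\<eta> k\<bar> \<le> c"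
  shows "\<exists>\<theta> \<in> carrier_vec dd. max_norm \<theta> \<le> c \<and>
    (\<forall>x\<in>carrier_vec d. clipped_dnn u v \<theta> l x $ 0 = real_of_ereal (max u (min
       (ereal (Max ((\<lambda>k. \<eta> k - L * l1_norm (x - y k)) ` {..<K}))) v)))"
proof -
  define X where "X = (carrier_vec d :: real vec set)"
  define z where "z x k = \<eta> k - L * l1_norm (x - y k)" for x k
  define M where "M x i = Max (z x ` {..i})" for x i
  have M0: "M x 0 = z x 0" for x by (simp add: M_def)
  have MS: "M x (Suc i) = max (M x i) (z x (Suc i))" for x i
    by (simp add: M_def atMost_Suc max.commute)
  \<comment> \<open>For \<open>2 \<le> k \<le> K\<close>, put \<open>i = k - 1\<close>: neurons \<open>2 t\<close> and \<open>2 t + 1\<close> of layer \<open>k\<close> hold the positive and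
    negative parts of \<open>z (i + t)\<close>, and the last one holds the excess of \<open>M (i - 1)\<close> over \<open>z i\<close>. Putting
    the excess last keeps the layout of the pairs independent of \<open>i\<close>.\<close>
  define pre where "pre k x n =
    (if k = LL then M x (K - 1)
     else if k = 1 then
       (if n < 2 * d * K then
          (if even n then x $ (n div 2 mod d) - y (n div (2 * d)) $ (n div 2 mod d)
           else - (x $ (n div 2 mod d) - y (n div (2 * d)) $ (n div 2 mod d))) else 0)
     else if k \<le> K then
       (if n < 2 * (K - (k - 1)) then
          (if even n then z x (k - 1 + n div 2) else - z x (k - 1 + n div 2))
        else if n = 2 * (K - (k - 1)) then M x (k - 2) - z x (k - 1) else 0)
     else if n = 0 then M x (K - 1) else if n = 1 then - M x (K - 1) else 0)" for k x n
  define h where "h k x n = (if k = 0 then x $ n else max (pre k x n) 0)" for k x n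
  have c0: "c \<ge> 0" using c by simp
  have zero: "affinely_representable c n H X (\<lambda>x. 0)" for n H
    by (rule affinely_representable_zero[OF c0])
  note uminus = affinely_representable_uminus

  \<comment> \<open>Layer 1 consists of \<open>K\<close> blocks of \<open>2 * d\<close> neurons, one
    block for each \<open>y k\<close>, and \<open>n div (2 * d)\<close> is the block of neuron
    \<open>n\<close>. A common weight on a block produces a multiple of the distance to its centre;
    surplus neurons get weight 0.\<close>
  have layer1_sum: "(\<Sum>n<l ! 1. (if n < 2 * d * K then w (n div (2 * d)) else 0) * h 1 x n)
      = (\<Sum>k<K. w k * l1_norm (x - y k))" if "x \<in> X" for w x
  proof -
    have "(\<Sum>n<l ! 1. (if n < 2 * d * K then w (n div (2 * d)) else 0) * h 1 x n)
        = (\<Sum>n<K * (2 * d). w (n div (2 * d)) * h 1 x n)"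
      using l1 by (intro sum.mono_neutral_cong_right) (auto simp: mult.commute mult.left_commute)
    also have "\<dots> = (\<Sum>k<K. \<Sum>n=k*(2*d)..<k*(2*d)+2*d. w (n div (2 * d)) * h 1 x n)"
      by (rule sum.nat_group[symmetric])
    also have "\<dots> = (\<Sum>k<K. w k * l1_norm (x - y k))"
    proof (rule sum.cong[OF refl])
      fix k assume "k \<in> {..<K}"
      then have k: "k < K" by simp
      have "(\<Sum>n=k*(2*d)..<k*(2*d)+2*d. w (n div (2 * d)) * h 1 x n)
          = (\<Sum>n<2 * d. w ((n + k*(2*d)) div (2 * d)) * h 1 x (n + k*(2*d)))"
        using sum.shift_bounds_nat_ivl[of "\<lambda>n. w (n div (2 * d)) * h 1 x n" 0 "k*(2*d)" "2*d"]
        by (simp add: atLeast0LessThan add.commute)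
      also have "\<dots> = (\<Sum>n<2 * d. w k * max (if even n
          then x $ (n div 2) - y k $ (n div 2) else - (x $ (n div 2) - y k $ (n div 2))) 0)"
      proof (rule sum.cong[OF refl])
        fix n assume "n \<in> {..<2 * d}"
        then have n: "n < 2 * d" by simp
        have "n + k * (2 * d) = n + k * d * 2" by simp
        then have "(n + k * (2 * d)) div 2 = n div 2 + k * d"
          using div_mult_self1[of 2 n "k * d"] by simp
        then have m: "(n + k * (2 * d)) div 2 mod d = n div 2" using n by simp
        have q: "(n + k * (2 * d)) div (2 * d) = k" using n d by simp
        have "n + k * (2 * d) < Suc k * (2 * d)" using n by simp
        also have "\<dots> \<le> K * (2 * d)" using k by (intro mult_le_mono1) simp
        finally have "n + k * (2 * d) < 2 * d * K" by (simp add: mult.commute)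
        then show "w ((n + k*(2*d)) div (2 * d)) * h 1 x (n + k*(2*d)) = w k * max (if even n
          then x $ (n div 2) - y k $ (n div 2) else - (x $ (n div 2) - y k $ (n div 2))) 0"
          using LL K unfolding h_def pre_def q m by simp
      qed
      also have "\<dots> = w k * l1_norm (x - y k)"
        using sum_abs_as_relu[of "\<lambda>j. x $ j - y k $ j" d]
        by (simp only: sum_distrib_left[symmetric] l1_norm_minus[OF y(1)[OF k]])
      finally show "(\<Sum>n=k*(2*d)..<k*(2*d)+2*d. w (n div (2 * d)) * h 1 x n)
        = w k * l1_norm (x - y k)" .
    qed
    finally show ?thesis .
  qed
  have layer1: "affinely_representable c (l ! 1) (h 1) X g"
    if "\<And>k. \<bar>w k\<bar> \<le> c" "\<bar>\<beta>\<bar> \<le> c" "\<And>x. x \<in> X \<Longrightarrow> g x = (\<Sum>k<K. w k * l1_norm (x - y k)) + \<beta>" for w \<beta> g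
    by (rule affinely_representableI[where w = "\<lambda>n. if n < 2 * d * K then w (n div (2 * d)) else 0"
          and \<beta> = \<beta>])
      (use that layer1_sum c0 in auto)
  have z_layer1: "affinely_representable c (l ! 1) (h 1) X (\<lambda>x. z x k)" if "k < K" for k
    by (rule layer1[where w = "\<lambda>i. if i = k then - L else 0" and \<beta> = "\<eta> k"])
      (use c \<eta>[OF that] that in \<open>auto simp: z_def if_distrib[of "\<lambda>t. t * _"] cong: if_cong\<close>)
  \<comment> \<open>Since \<open>M x 0 = z x 0\<close>, this is the first excess. Its bias combines
    two values of \<open>\<eta>\<close>, which explains the factor 2 in the bound on
    \<open>\<eta>\<close>.\<close>
  have diff_layer1: "affinely_representable c (l ! 1) (h 1) X (\<lambda>x. z x 0 - z x 1)"
  proof (rule layer1[where w = "\<lambda>i. (if i = 0 then - L else 0) + (if i = 1 then L else 0)"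
        and \<beta> = "\<eta> 0 - \<eta> 1"])
    show "\<bar>\<eta> 0 - \<eta> 1\<bar> \<le> c" using \<eta>[of 0] \<eta>[of 1] K by linarith
  qed (use c K in \<open>auto simp: z_def distrib_right sum.distrib if_distrib[of "\<lambda>t. t * _"] cong: if_cong\<close>)

  have h_pos: "h (Suc i) x (2 * t) = max (z x (i + t)) 0"
    and h_neg: "h (Suc i) x (Suc (2 * t)) = max (- z x (i + t)) 0"
    if "1 \<le> i" "i < K" "t < K - i" "Suc i < LL" for i t x
  proof -
    have "Suc (2 * t) < 2 * (K - i)" "Suc i \<noteq> LL" "i \<noteq> 0" using that by auto
    then show "h (Suc i) x (2 * t) = max (z x (i + t)) 0"
      "h (Suc i) x (Suc (2 * t)) = max (- z x (i + t)) 0"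
      using that by (simp_all add: h_def pre_def)
  qed
  have h_excess: "h (Suc i) x (2 * (K - i)) = max (M x (i - 1) - z x i) 0"
    if "1 \<le> i" "i < K" "Suc i < LL" for i x
    using that by (simp add: h_def pre_def)
  have width: "l ! Suc i \<ge> 2 * (K - i) + 1" if i: "1 \<le> i" "i < K" "Suc i < LL" for i
  proof -
    have "2 * K + 3 \<le> l ! Suc i + 2 * Suc i" using li[of "Suc i"] i by simp
    moreover obtain e where "K = i + e" using i(2) less_imp_add_positive by blast
    ultimately show ?thesis by simp
  qed
  \<comment> \<open>The identity for \<open>max m z\<close> with \<open>M x (i - 1)\<close> and
    \<open>z x i\<close>: neurons 0 and 1 hold the parts of \<open>z x i\<close>, and the last
    neuron holds the excess.\<close>
  have M_rec: "M x i = h (Suc i) x 0 + h (Suc i) x (2 * (K - i)) - h (Suc i) x 1"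
    if i: "1 \<le> i" "i < K" "Suc i < LL" for i x
  proof -
    obtain i' where "i = Suc i'" using i by (cases i) auto
    then have "M x i = max (M x (i - 1)) (z x i)" by (simp add: MS)
    then show ?thesis
      using h_pos[OF i(1,2) _ i(3), of 0 x] h_neg[OF i(1,2) _ i(3), of 0 x] h_excess[OF i] i
      by (simp add: max_def)
  qed
  have z_layer: "affinely_representable c (l ! Suc i) (h (Suc i)) X (\<lambda>x. z x (i + t))"
    if i: "1 \<le> i" "i < K" "t < K - i" "Suc i < LL" for i t
  proof (rule affinely_representable_sum_diff[where P = "{2 * t}" and Q = "{Suc (2 * t)}"])
    show "{2 * t} \<subseteq> {..<l ! Suc i}" "{Suc (2 * t)} \<subseteq> {..<l ! Suc i}"
      using i width[of i] by auto
    show "z x (i + t) = (\<Sum>j\<in>{2 * t}. h (Suc i) x j) - (\<Sum>j\<in>{Suc (2 * t)}. h (Suc i) x j)" for x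
      by (simp add: h_pos[OF i] h_neg[OF i] max_def)
  qed (use c in auto)
  have M_layer: "affinely_representable c (l ! Suc i) (h (Suc i)) X (\<lambda>x. M x i)"
    if i: "1 \<le> i" "i < K" "Suc i < LL" for i
  proof (rule affinely_representable_sum_diff[where P = "{0, 2 * (K - i)}" and Q = "{1}"])
    show "{0, 2 * (K - i)} \<subseteq> {..<l ! Suc i}" "{1} \<subseteq> {..<l ! Suc i}"
      using i width[of i] by auto
    show "{0, 2 * (K - i)} \<inter> {1} = {}" by auto
    show "M x i = (\<Sum>j\<in>{0, 2 * (K - i)}. h (Suc i) x j) - (\<Sum>j\<in>{1}. h (Suc i) x j)" for x
      using i by (simp add: M_rec[OF i])
  qed (use c in auto)
  \<comment> \<open>Three neurons give \<open>M x i\<close>; neurons 2 and 3 hold the parts of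
    \<open>z x (Suc i)\<close> and enter with reversed signs. As \<open>Suc i < K\<close>, the
    excess has index at least 4 and does not collide with them.\<close>
  have diff_layer: "affinely_representable c (l ! Suc i) (h (Suc i)) X (\<lambda>x. M x i - z x (Suc i))"
    if i: "1 \<le> i" "Suc i < K" "Suc i < LL" for i
  proof (rule affinely_representable_sum_diff[where P = "{0, 2 * (K - i), 3}" and Q = "{1, 2}"])
    have ne: "2 * (K - i) \<noteq> 3" "2 * (K - i) \<noteq> 2" "2 * (K - i) \<noteq> 1" "2 * (K - i) \<noteq> 0"
      using i by presburger+
    show "{0, 2 * (K - i), 3} \<subseteq> {..<l ! Suc i}" "{1, 2} \<subseteq> {..<l ! Suc i}"
      using i width[of i] by auto
    show "{0, 2 * (K - i), 3} \<inter> {1, 2} = {}" using ne by auto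
    fix x
    have "(\<Sum>j\<in>{0, 2 * (K - i), 3}. h (Suc i) x j)
        = h (Suc i) x 0 + h (Suc i) x (2 * (K - i)) + h (Suc i) x 3"
      using ne ne[symmetric] by simp
    moreover have "h (Suc i) x 2 = max (z x (Suc i)) 0" "h (Suc i) x 3 = max (- z x (Suc i)) 0"
      using h_pos[of i 1 x] h_neg[of i 1 x] i by (auto simp: numeral_eq_Suc)
    ultimately show "M x i - z x (Suc i)
      = (\<Sum>j\<in>{0, 2 * (K - i), 3}. h (Suc i) x j) - (\<Sum>j\<in>{1, 2}. h (Suc i) x j)"
      using i by (simp add: M_rec max_def)
  qed (use c in auto)
  have carry: "affinely_representable c (l ! Suc i) (h (Suc i)) X (\<lambda>x. M x (K - 1))"
    if i: "K \<le> Suc i" "Suc i < LL" for i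
  \<comment> \<open>Layer \<open>K\<close> still has the layout with an excess; every later hidden
    layer holds just the two parts of the final maximum.\<close>
  proof (cases "i < K")
    case True
    then have "i = K - 1" using i by simp
    then show ?thesis using M_layer[of i] K i by simp
  next
    case False
    then have "h (Suc i) x 0 = max (M x (K - 1)) 0" "h (Suc i) x 1 = max (- M x (K - 1)) 0" for x
      using i K by (simp_all add: h_def pre_def)
    then show ?thesis
      by (intro affinely_representable_sum_diff[where P = "{0}" and Q = "{1}"])
        (use i K c li[of "Suc i"] in \<open>auto simp: max_def\<close>)
  qed

  have rep: "affinely_representable c (l ! k) (h k) X (\<lambda>x. pre (Suc k) x n)" if k: "k < LL" for k n
  proof -
    \<comment> \<open>The inputs are the coordinates of \<open>x\<close>, the distance blocks of
      layer 1, or the pairs of a later layer.\<close>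
    consider "k = 0" | "k = 1" | i where "k = Suc i" "1 \<le> i" by (cases k; cases "k - 1") auto
    then show ?thesis
    proof cases
      case 1
      show ?thesis
      proof (cases "n < 2 * d * K")
        case True
        define j where "j = n div 2 mod d"
        have j: "j < d" using d by (simp add: j_def)
        have q: "n div (2 * d) < K" using True by (simp add: less_mult_imp_div_less mult.commute)
        have "affinely_representable c (l ! 0) (h 0) X (\<lambda>x. x $ j - y (n div (2 * d)) $ j)"
          by (rule affinely_representableI[where w = "\<lambda>i. if i = j then 1 else 0"
                and \<beta> = "- (y (n div (2 * d)) $ j)"])
            (use c y(2)[OF q j] j l0 in \<open>auto simp: h_def if_distrib[of "\<lambda>t. t * _"] cong: if_cong\<close>)
        then show ?thesis
          using 1 True LL K uminus by (cases "even n") (fastforce simp: pre_def j_def)+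
      next
        case False
        then show ?thesis using 1 LL K zero by (simp add: pre_def)
      qed
    next
      case 2
      have "1 + n div 2 < K" if "n < 2 * (K - 1)" using that by linarith
      then show ?thesis
        using 2 LL K z_layer1[of "1 + n div 2"] uminus[OF z_layer1[of "1 + n div 2"]] diff_layer1 zero
        by (cases "n < 2 * (K - 1)"; cases "even n"; cases "n = 2 * (K - 1)") (simp_all add: pre_def M0)
    next
      case 3
      show ?thesis
      proof (cases "Suc k = LL \<or> \<not> Suc k \<le> K")
        case True
        then have "K \<le> Suc i" using LL 3 by auto
        from carry[OF this] uminus[OF carry[OF this]] show ?thesis
          using True 3 k zero
          by (cases "Suc k = LL"; cases "n = 0"; cases "n = 1") (simp_all add: pre_def)
      next
        case False
        have "Suc (n div 2) < K - i" if "n < 2 * (K - Suc i)" using that by linarith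
        then show ?thesis
          using False 3 k zero diff_layer[of i] z_layer[of i "Suc (n div 2)"]
            uminus[OF z_layer[of i "Suc (n div 2)"]]
          by (cases "n < 2 * (K - Suc i)"; cases "even n"; cases "n = 2 * (K - Suc i)")
            (simp_all add: pre_def)
      qed
    qed
  qed
  have "\<exists>\<theta> \<in> carrier_vec dd. max_norm \<theta> \<le> c \<and>
    (\<forall>x\<in>X. clipped_dnn u v \<theta> l x $ 0 = real_of_ereal (max u (min (ereal (pre LL x 0)) v)))"
    by (rule clipped_dnn_realizes[OF len _ c0 dd dim _ out, where h = h])
      (use LL l0 rep in \<open>auto simp: X_def h_def\<close>)
  moreover have "{..K - 1} = {..<K}" using K by auto
  ultimately show ?thesis by (simp add: X_def pre_def M_def z_def[abs_def])
qed

section \<open>The approximation result\<close>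

text \<open>Clipping is nonexpansive and fixes \<open>r\<close>.\<close>

lemma abs_clip_diff_le:
  assumes "u \<le> ereal r" "ereal r \<le> v"
  shows "\<bar>real_of_ereal (max u (min (ereal t) v)) - r\<bar> \<le> \<bar>t - r\<bar>"
  using assms by (cases u; cases v) (auto simp: max_def min_def)

text \<open>Turns \<open>2 * d * N ^ d\<close> into at most \<open>(2 * N) ^ d\<close>, which the
  choice of \<open>N\<close> keeps below \<open>A\<close>.\<close>

lemma double_le_two_power: "2 * d \<le> 2 ^ d" if "d \<ge> 1" for d :: nat
  using that by (induction d rule: dec_induct) auto

theorem proposition3p5:
  fixes d dd LL :: nat
    and A L a b :: real
    and u v :: ereal
    and l :: "nat list"
    and f :: "real vec \<Rightarrow> real"
  assumes "d \<ge> 1" and "dd \<ge> 1" and "LL \<ge> 1"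
    and "A > 0" and "a < b" and "u < \<infinity>" and "u < v"
    and "length l = LL + 1" and "\<forall>i \<le> LL. l ! i \<ge> 1"
    and "real LL \<ge> A * indicator {6 ^ d<..} A / (2 * real d) + 1"
    and "l ! 0 = d"
    and "real (l ! 1) \<ge> A * indicator {6 ^ d<..} A"
    and "l ! LL = 1"
    and "dd \<ge> (\<Sum>i = 1..LL. l ! i * (l ! (i - 1) + 1))"
    and "\<forall>i. 2 \<le> i \<and> i < LL \<longrightarrow>
           real (l ! i) \<ge> indicator {6 ^ d<..} A * max (A / real d - 2 * real i + 3) 2"
    and "\<forall>x \<in> cube a b d. u \<le> ereal (f x) \<and> ereal (f x) \<le> v"
    and "\<forall>x \<in> cube a b d. \<forall>y \<in> cube a b d. \<bar>f x - f y\<bar> \<le> L * l1_norm (x - y)"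
  shows "\<exists>\<theta> \<in> carrier_vec dd.
           max_norm \<theta> \<le> Max {1, L, \<bar>a\<bar>, \<bar>b\<bar>, 2 * (SUP x \<in> cube a b d. \<bar>f x\<bar>)} \<and>
           (SUP x \<in> cube a b d. \<bar>clipped_dnn u v \<theta> l x $ 0 - f x\<bar>)
             \<le> 3 * real d * L * (b - a) / A powr (1 / real d)"
proof -
  define c where "c = Max {1, L, \<bar>a\<bar>, \<bar>b\<bar>, 2 * (SUP x \<in> cube a b d. \<bar>f x\<bar>)}"
  have c: "1 \<le> c" "L \<le> c" "\<bar>a\<bar> \<le> c" "\<bar>b\<bar> \<le> c" "2 * (SUP x \<in> cube a b d. \<bar>f x\<bar>) \<le> c"
    unfolding c_def by (rule Max_ge; simp)+
  note lip = assms(17)[rule_format]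
  \<comment> \<open>The sign of \<open>L\<close> follows from the Lipschitz condition at two
    opposite corners, whose distance is positive.\<close>
  have corners: "vec d (\<lambda>_. a) \<in> cube a b d" "vec d (\<lambda>_. b) \<in> cube a b d"
    using assms(5) by (auto simp: cube_def)
  have "0 \<le> L * l1_norm (vec d (\<lambda>_. a) - vec d (\<lambda>_. b) :: real vec)"
    using lip[OF corners] by linarith
  moreover have "l1_norm (vec d (\<lambda>_. a) - vec d (\<lambda>_. b) :: real vec) = real d * (b - a)"
    using assms(5) by (simp add: l1_norm_def)
  moreover have "real d * (b - a) > 0" using assms(1,5) by simp
  ultimately have L0: "L \<ge> 0" by (simp add: zero_le_mult_iff)
  \<comment> \<open>A real supremum is an upper bound only for a set known to be bounded, so
    boundedness of \<open>f\<close> is derived first.\<close>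
  have "\<bar>f x\<bar> \<le> \<bar>f (vec d (\<lambda>_. a))\<bar> + L * (real d * (b - a))" if x: "x \<in> cube a b d" for x
  proof -
    have "l1_norm (x - vec d (\<lambda>_. a)) \<le> real d * (b - a)"
      using cubeD(2)[OF x] by (intro l1_norm_minus_le) auto
    then have "L * l1_norm (x - vec d (\<lambda>_. a)) \<le> L * (real d * (b - a))"
      using L0 by (rule mult_left_mono)
    then show ?thesis using lip[OF x corners(1)] by linarith
  qed
  then have bdd: "bdd_above ((\<lambda>x. \<bar>f x\<bar>) ` cube a b d)" by (intro bdd_aboveI2)
  have f_le: "2 * \<bar>f x\<bar> \<le> c" if "x \<in> cube a b d" for x
    using cSUP_upper[OF that bdd] c(5) by linarith
  define t where "t = A powr (1 / real d)"
  have t: "t > 0" "t ^ d = A"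
    using assms(1,4) by (simp_all add: t_def powr_power)
  \<comment> \<open>Here \<open>g\<close> is the network output before clipping; both cases bound
    its error.\<close>
  have "\<exists>g. (\<forall>x\<in>cube a b d. \<bar>g x - f x\<bar> \<le> 3 * real d * L * (b - a) / t) \<and>
    (\<exists>\<theta> \<in> carrier_vec dd. max_norm \<theta> \<le> c \<and>
      (\<forall>x\<in>cube a b d. clipped_dnn u v \<theta> l x $ 0 = real_of_ereal (max u (min (ereal (g x)) v))))"
  proof (cases "A \<le> 6 ^ d")
    case True
    have "t \<le> 6" using True t power_le_imp_le_base[of t "d - 1" 6] assms(1) by simp
    obtain y where y: "y \<in> cube a b d"
      "\<And>x j. x \<in> cube a b d \<Longrightarrow> j < d \<Longrightarrow> \<bar>x $ j - y $ j\<bar> \<le> (b - a) / 2"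
      using cube_grid[OF assms(5), of 1 d] by auto
    \<comment> \<open>All weights vanish and the output bias is \<open>f y\<close>, so the layers
      may have any widths.\<close>
    define pre where "pre k x n = (if k = LL then f y else 0)" for k n :: nat and x :: "real vec"
    have "\<exists>\<theta> \<in> carrier_vec dd. max_norm \<theta> \<le> c \<and> (\<forall>x\<in>cube a b d. clipped_dnn u v \<theta> l x $ 0
        = real_of_ereal (max u (min (ereal (pre LL x 0)) v)))"
    proof (rule clipped_dnn_realizes[where h = "\<lambda>k x n. if k = 0 then x $ n else max (pre k x n) 0"])
      show "affinely_representable c (l ! k) (\<lambda>x n. if k = 0 then x $ n else max (pre k x n) 0)
          (cube a b d) (\<lambda>x. pre (Suc k) x i)" for k i
        using f_le[OF y(1)] c(1)
        by (intro affinely_representableI[where w = "\<lambda>_. 0" and \<beta> = "if Suc k = LL then f y else 0"])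
          (auto simp: pre_def)
    qed (use assms c(1) in \<open>auto simp: cube_def\<close>)
    moreover have "\<bar>f y - f x\<bar> \<le> 3 * real d * L * (b - a) / t" if x: "x \<in> cube a b d" for x
    proof -
      have "\<bar>f y - f x\<bar> \<le> L * l1_norm (x - y)" using lip[OF x y(1)] by (simp add: abs_minus_commute)
      also have "\<dots> \<le> L * (real d * ((b - a) / 2))"
        using L0 cubeD(1)[OF y(1)] y(2)[OF x] by (intro mult_left_mono l1_norm_minus_le)
      also have "\<dots> = 3 * real d * L * (b - a) / 6" by simp
      also have "\<dots> \<le> 3 * real d * L * (b - a) / t"
        using L0 assms(5) t(1) \<open>t \<le> 6\<close> by (intro divide_left_mono) auto
      finally show ?thesis .
    qed
    ultimately show ?thesis by (intro exI[of _ "\<lambda>_. f y"]) (simp add: pre_def)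
  next
    case False
    then have ind: "indicator {6 ^ d<..} A = (1 :: real)" by simp
    have "t > 6" using False t power_mono[of t 6 d] by force
    define N where "N = nat \<lfloor>t / 2\<rfloor>"
    define K where "K = N ^ d"
    \<comment> \<open>From \<open>t > 6\<close> it follows that
      \<open>N > t / 2 - 1 > t / 3\<close>; this is the source of the constant 3.\<close>
    have N: "N \<ge> 3" "real N \<le> t / 2" "t \<le> 3 * real N" using \<open>t > 6\<close> unfolding N_def by linarith+
    have "K \<ge> N" using self_le_power[of N d] N(1) assms(1) by (simp add: K_def)
    have "2 * real d * real K \<le> 2 ^ d * real K"
      using double_le_two_power[OF assms(1)]
      by (intro mult_right_mono) (simp_all flip: of_nat_le_iff[where ?'a = real])
    also have "\<dots> = (2 * real N) ^ d" by (simp add: K_def power_mult_distrib)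
    also have "\<dots> \<le> t ^ d" using N(2) by (intro power_mono) auto
    finally have KA: "2 * real d * real K \<le> A" using t by simp
    obtain y where y: "\<And>k. k < K \<Longrightarrow> y k \<in> cube a b d" "\<And>x. x \<in> cube a b d \<Longrightarrow>
        \<exists>k<K. \<forall>j<d. \<bar>x $ j - y k $ j\<bar> \<le> (b - a) / (2 * real N)"
      using cube_grid[OF assms(5), of N d] N(1) unfolding K_def by auto
    \<comment> \<open>The first bound serves the depth, the second the widths of layers 2 and above,
      and \<open>KA\<close> itself the width of layer 1.\<close>
    have KA': "real K \<le> A / (2 * real d)" "2 * real K \<le> A / real d"
      using KA assms(1) by (simp_all add: le_divide_eq mult_ac)
    define m where "m x = Max ((\<lambda>k. f (y k) - L * l1_norm (x - y k)) ` {..<K})" for x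
    have "\<exists>\<theta> \<in> carrier_vec dd. max_norm \<theta> \<le> c \<and> (\<forall>x\<in>carrier_vec d.
        clipped_dnn u v \<theta> l x $ 0 = real_of_ereal (max u (min (ereal (m x)) v)))"
      unfolding m_def
    proof (rule max_network)
      show "K \<ge> 2" using \<open>K \<ge> N\<close> N(1) by simp
      show "LL \<ge> K + 1"
        using assms(10) KA'(1) unfolding ind by (simp flip: of_nat_le_iff[where ?'a = real])
      have "real (2 * d * K) \<le> real (l ! 1)" using assms(12) KA unfolding ind by simp
      then show "l ! 1 \<ge> 2 * d * K" by (simp only: of_nat_le_iff)
      show "l ! i \<ge> 2 \<and> l ! i + 2 * i \<ge> 2 * K + 3" if "2 \<le> i" "i < LL" for i
      proof -
        have "max (A / real d - 2 * real i + 3) 2 \<le> real (l ! i)"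
          using assms(15)[rule_format, OF conjI[OF that]] unfolding ind by simp
        then have "2 * real K - 2 * real i + 3 \<le> real (l ! i)" "2 \<le> real (l ! i)"
          using KA'(2) by linarith+
        then show ?thesis by linarith
      qed
      show "y k \<in> carrier_vec d" if "k < K" for k using cubeD(1)[OF y(1)[OF that]] .
      show "\<bar>y k $ j\<bar> \<le> c" if "k < K" "j < d" for k j
        using cubeD(2)[OF y(1)[OF that(1)] that(2)] c(3,4) by auto
      show "2 * \<bar>f (y k)\<bar> \<le> c" if "k < K" for k using f_le[OF y(1)[OF that]] .
    qed (use assms c L0 in auto)
    moreover have "\<bar>m x - f x\<bar> \<le> 3 * real d * L * (b - a) / t" if x: "x \<in> cube a b d" for x
    proof -
      obtain k where k: "k < K" "\<forall>j<d. \<bar>x $ j - y k $ j\<bar> \<le> (b - a) / (2 * real N)"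
        using y(2)[OF x] by blast
      have "m x \<le> f x"
        unfolding m_def
      proof (rule Max.boundedI)
        fix r assume "r \<in> (\<lambda>k. f (y k) - L * l1_norm (x - y k)) ` {..<K}"
        then obtain k' where "k' < K" "r = f (y k') - L * l1_norm (x - y k')" by blast
        then show "r \<le> f x" using lip[OF x y(1)[of k']] by linarith
      qed (use k(1) in auto)
      moreover have "f (y k) - L * l1_norm (x - y k) \<le> m x"
        unfolding m_def using k(1) by (intro Max_ge) auto
      moreover have "\<bar>f x - f (y k)\<bar> \<le> L * l1_norm (x - y k)" using lip[OF x y(1)[OF k(1)]] .
      ultimately have "\<bar>m x - f x\<bar> \<le> 2 * (L * l1_norm (x - y k))" by linarith
      also have "\<dots> \<le> 2 * (L * (real d * ((b - a) / (2 * real N))))"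
        using L0 cubeD(1)[OF y(1)[OF k(1)]] k(2) by (intro mult_left_mono l1_norm_minus_le) auto
      also have "\<dots> = 3 * real d * L * (b - a) / (3 * real N)" by simp
      also have "\<dots> \<le> 3 * real d * L * (b - a) / t"
        using L0 assms(5) t(1) N by (intro divide_left_mono) auto
      finally show ?thesis .
    qed
    ultimately show ?thesis using cubeD(1) by (intro exI[of _ m]) blast
  qed
  then obtain g \<theta> where g: "\<And>x. x \<in> cube a b d \<Longrightarrow> \<bar>g x - f x\<bar> \<le> 3 * real d * L * (b - a) / t"
    and \<theta>: "\<theta> \<in> carrier_vec dd" "max_norm \<theta> \<le> c"
      "\<And>x. x \<in> cube a b d \<Longrightarrow>
        clipped_dnn u v \<theta> l x $ 0 = real_of_ereal (max u (min (ereal (g x)) v))"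
    by blast
  have "\<bar>clipped_dnn u v \<theta> l x $ 0 - f x\<bar> \<le> 3 * real d * L * (b - a) / t"
    if "x \<in> cube a b d" for x
    using abs_clip_diff_le[of u "f x" v "g x"] assms(16) g[OF that] \<theta>(3)[OF that] that by fastforce
  then have "(SUP x \<in> cube a b d. \<bar>clipped_dnn u v \<theta> l x $ 0 - f x\<bar>) \<le> 3 * real d * L * (b - a) / t"
    using corners(1) by (intro cSUP_least) auto
  then show ?thesis using \<theta>(1,2) unfolding c_def t_def by blast
qed

end
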